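(* Let $n_1,n_2$ be positive integers and $n=\min\{n_1,n_2\}$. Let $f\in\mathcal{A}_{n_1}$ and $g\in\mathcal{A}_{n_2}\cap\mathcal{S}^{*}$. Let $\beta\ge 0$, $\gamma\ge 0$ be real with $\beta+\gamma>0$, let $0<\mu\le 1$ be real, and let $\delta\in\mathbb{C}$ satisfy $\mathrm{Re}(\delta)>-\frac{\mu n}{2}$. Suppose that $$ \left|\left(\frac{zf'(z)}{g(z)}\right)^{\frac1\mu}-1\right|^{\beta}\left(\mathrm{Re}\left(\delta+1+\frac{zf''(z)}{f'(z)}-\frac{zg'(z)}{g(z)}\right)\right)^{\gamma}<\left(\mathrm{Re}(\delta)+\frac{\mu n}{2}\right)^{\gamma}\qquad\text{for all } z\in\mathbb{U}. $$ Then $$ \left|\left(\frac{zf'(z)}{g(z)}\right)^{\frac1\mu}-1\right|<1\qquad\text{for all } z\in\mathbb{U}, $$ and consequently $f\in\mathcal{STC}(\mu)$.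
   Context: $\mathbb{U}=\{z\in\mathbb{C}:|z|<1\}$ is the open unit disk. For a positive integer $m$, $\mathcal{A}_m$ is the class of functions analytic in $\mathbb{U}$ of the form $f(z)=z+a_{m+1}z^{m+1}+a_{m+2}z^{m+2}+\cdots$; $\mathcal{A}=\mathcal{A}_1$ (which contains every $\mathcal{A}_m$). For $0\le\alpha<1$, $\mathcal{S}^{*}(\alpha)$ is the class of functions $g\in\mathcal{A}$ with $\mathrm{Re}\left(\frac{zg'(z)}{g(z)}\right)>\alpha$ for all $z\in\mathbb{U}$ (starlike of order $\alpha$), and $\mathcal{S}^{*}=\mathcal{S}^{*}(0)$. Quotients such as $zg'(z)/g(z)$ and $zf'(z)/g(z)$ are given their limiting value $1$ at $z=0$; $g$ has no zero in $\mathbb{U}\setminus\{0\}$. For $0<\mu\le1$, $\mathcal{STC}(\mu)$ (strongly close-to-convex functions of order $\mu$) is the class of $f\in\mathcal{A}$ for which there exists $g\in\mathcal{S}^{*}$ with $\mathrm{Re}\left(\left(\frac{zf'(z)}{g(z)}\right)^{1/\mu}\right)>0$ for all $z\in\mathbb{U}$. Conventions: the expressions in the hypothesis are understood to be well defined, so $f'(z)\ne0$ in $\mathbb{U}$. The power $(zf'(z)/g(z))^{1/\mu}$ is the analytic branch in $\mathbb{U}$ with value $1$ at $z=0$. Real powers have their usual meaning, with $x^0=1$ for all real $x$ (including $x=0$); when $\gamma$ is not a nonnegative integer, the hypothesis is understood to require that the real part raised to the power $\gamma$ be nonnegative. *)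

theory Defs
  imports "HOL-Complex_Analysis.Complex_Analysis"
begin

abbreviation unit_disk :: "complex set" where
  "unit_disk \<equiv> ball 0 1"

definition class_A :: "nat \<Rightarrow> (complex \<Rightarrow> complex) set" where
  "class_A m = {f. f holomorphic_on unit_disk \<and>
     (\<exists>a. \<forall>z\<in>unit_disk. (\<lambda>k. a k * z ^ (m + 1 + k)) sums (f z - z))}"

text \<open>
  The quotient \<open>z h'(z) / g(z)\<close> for normalised \<open>h\<close> and \<open>g\<close>; it has a removable
  singularity with value \<open>1\<close> at the origin.
\<close>

definition zderiv_quot :: "(complex \<Rightarrow> complex) \<Rightarrow> (complex \<Rightarrow> complex) \<Rightarrow> complex \<Rightarrow> complex" where
  "zderiv_quot h g z = (if z = 0 then 1 else z * deriv h z / g z)"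

definition starlike_order :: "real \<Rightarrow> (complex \<Rightarrow> complex) set" where
  "starlike_order \<alpha> = {g \<in> class_A 1. (\<forall>z\<in>unit_disk - {0}. g z \<noteq> 0) \<and>
     (\<forall>z\<in>unit_disk. Re (zderiv_quot g g z) > \<alpha>)}"

text \<open>
  The analytic branch in the disk of the power \<open>F\<^sup>a\<close> with value \<open>1\<close> at the origin. It is
  meaningful for \<open>F\<close> holomorphic and without zeros in the disk with \<open>F 0 = 1\<close>. The principal
  power \<^term>\<open>F z powr a\<close> would not do, since \<open>F\<close> may cross the negative real axis.
\<close>

definition disk_log :: "(complex \<Rightarrow> complex) \<Rightarrow> complex \<Rightarrow> complex" where
  "disk_log F = (SOME L. L holomorphic_on unit_disk \<and> L 0 = 0 \<and>
     (\<forall>z\<in>unit_disk. exp (L z) = F z))"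

definition disk_power :: "(complex \<Rightarrow> complex) \<Rightarrow> real \<Rightarrow> complex \<Rightarrow> complex" where
  "disk_power F a z = exp (of_real a * disk_log F z)"

lemma disk_log:
  assumes hol: "F holomorphic_on unit_disk" and nz: "\<And>z. z \<in> unit_disk \<Longrightarrow> F z \<noteq> 0"
    and F0: "F 0 = 1"
  shows "disk_log F holomorphic_on unit_disk" and "disk_log F 0 = 0"
    and "\<And>z. z \<in> unit_disk \<Longrightarrow> exp (disk_log F z) = F z"
proof -
  obtain M where M: "M holomorphic_on unit_disk" "\<And>z. z \<in> unit_disk \<Longrightarrow> F z = exp (M z)"
    using simply_connected_eq_holomorphic_log[OF open_ball, of "0::complex" 1]
      hol nz convex_imp_simply_connected[OF convex_ball, of "0::complex" 1]
    by metis
  have e0: "exp (M 0) = 1"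
    using M(2)[of 0] F0 by simp
  have "(\<lambda>z. M z - M 0) holomorphic_on unit_disk \<and> M 0 - M 0 = 0 \<and>
      (\<forall>z\<in>unit_disk. exp (M z - M 0) = F z)"
    using M e0 by (auto simp: exp_diff intro!: holomorphic_intros)
  then have "\<exists>L. L holomorphic_on unit_disk \<and> L 0 = 0 \<and> (\<forall>z\<in>unit_disk. exp (L z) = F z)"
    by (intro exI[of _ "\<lambda>z. M z - M 0"])
  from someI_ex[OF this, folded disk_log_def]
  show "disk_log F holomorphic_on unit_disk" "disk_log F 0 = 0"
    "\<And>z. z \<in> unit_disk \<Longrightarrow> exp (disk_log F z) = F z"
    by auto
qed

text \<open>The condition that \<open>f'\<close> has no zeros makes the branch of the power exist.\<close>

definition strongly_close_to_convex :: "real \<Rightarrow> (complex \<Rightarrow> complex) set" where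
  "strongly_close_to_convex \<mu> = {f \<in> class_A 1. (\<forall>z\<in>unit_disk. deriv f z \<noteq> 0) \<and>
     (\<exists>g\<in>starlike_order 0. \<forall>z\<in>unit_disk. Re (disk_power (zderiv_quot f g) (1 / \<mu>) z) > 0)}"

text \<open>
  Real powers with \<open>x\<^sup>0 = 1\<close> for all \<open>x\<close> (whereas \<^prop>\<open>(0::real) powr 0 = 0\<close>) and the usual signed
  integer powers of negative numbers. For exponents outside \<^term>\<open>\<nat> :: real set\<close> it is only
  meaningful for \<open>x \<ge> 0\<close>.
\<close>

definition real_power :: "real \<Rightarrow> real \<Rightarrow> real" where
  "real_power x a = (if a \<in> \<nat> then x ^ nat \<lfloor>a\<rfloor> else x powr a)"

end

theory Submission
  imports Defs
begin

text \<open>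
  Write \<open>p = (z f' / g)\<^bsup>1/\<mu>\<^esup> = 1 + w\<close>. Then \<open>w\<close> vanishes at \<open>0\<close> to order at least \<open>n\<close>, and
  logarithmic differentiation gives \<open>1 + z f'' / f' - z g' / g = \<mu> z w' / (1 + w)\<close>.
  If \<open>|w|\<close> is not below \<open>1\<close> everywhere, let \<open>z\<^sub>0\<close> be a point of least modulus with
  \<open>|w(z\<^sub>0)| \<ge> 1\<close>. By Jack's lemma \<open>z\<^sub>0 w'(z\<^sub>0) = k w(z\<^sub>0)\<close> with \<open>k \<ge> n\<close>, and
  \<open>Re (w / (1 + w)) = 1/2\<close> on \<open>|w| = 1\<close>, so that at \<open>z\<^sub>0\<close> the left-hand side of the hypothesis is
  \<open>(Re \<delta> + \<mu> k / 2)\<^sup>\<gamma> \<ge> (Re \<delta> + \<mu> n / 2)\<^sup>\<gamma>\<close>, a contradiction.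
\<close>

section \<open>Jack's lemma: the derivative at a point of maximal modulus\<close>

text \<open>The squared modulus is the real inner product of \<open>w (c s)\<close> with itself, so
  the product rule applies. Jack's lemma uses this along the ray and along the circle through
  \<open>z0\<close>.\<close>

lemma has_real_derivative_cmod_sq_comp:
  fixes c :: "real \<Rightarrow> complex"
  assumes "(w has_field_derivative w') (at (c t))" and "(c has_vector_derivative v) (at t)"
  shows "((\<lambda>s. (cmod (w (c s)))\<^sup>2) has_real_derivative 2 * Re (cnj (w (c t)) * (w' * v))) (at t)"
proof -
  have d: "((\<lambda>s. w (c s)) has_vector_derivative v * w') (at t)"
    using field_vector_diff_chain_at[OF assms(2,1)] by (simp add: o_def)
  have "((\<lambda>s. w (c s) \<bullet> w (c s)) has_vector_derivative
      w (c t) \<bullet> (v * w') + (v * w') \<bullet> w (c t)) (at t)"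
    using bounded_bilinear.has_vector_derivative[OF bounded_bilinear_inner d d] .
  moreover have "w (c t) \<bullet> (v * w') + (v * w') \<bullet> w (c t) = 2 * Re (cnj (w (c t)) * (w' * v))"
    by (simp add: inner_complex_def algebra_simps)
  ultimately show ?thesis
    by (simp add: has_real_derivative_iff_has_vector_derivative dot_square_norm)
qed

text \<open>
  At a point where \<open>|w|\<close> is maximal on the closed disk through it, the angular derivative of
  \<open>|w|\<^sup>2\<close> vanishes, while comparison with \<open>t \<mapsto> t\<^sup>n |w(z\<^sub>0)|\<close>, which dominates
  \<open>|w(t z\<^sub>0)|\<close> by the maximum principle for \<open>w / z\<^sup>n\<close>, bounds the radial derivative below.
\<close>

lemma jack_lemma:
  assumes hol: "w holomorphic_on ball 0 R" "h holomorphic_on ball 0 R"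
    and ord: "\<And>z. z \<in> ball 0 R \<Longrightarrow> w z = z ^ n * h z"
    and z0: "z0 \<in> ball 0 R" "w z0 \<noteq> 0" "z0 \<noteq> 0"
    and max: "\<And>z. cmod z \<le> cmod z0 \<Longrightarrow> cmod (w z) \<le> cmod (w z0)"
  obtains k where "k \<ge> real n" "z0 * deriv w z0 = of_real k * w z0"
proof -
  define r M where "r = cmod z0" and "M = cmod (w z0)"
  have r: "0 < r" "r < R" and M: "M > 0"
    using z0 by (auto simp: r_def M_def)
  have sub: "cball 0 r \<subseteq> ball (0::complex) R"
    using r by auto
  have dw: "(w has_field_derivative deriv w z0) (at z0)"
    using hol(1) z0(1) holomorphic_derivI by blast
  have hbound: "cmod (h z) \<le> M / r ^ n" if "z \<in> cball 0 r" for z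
  proof (rule maximum_modulus_frontier[of h "cball 0 r"])
    have "h holomorphic_on cball 0 r"
      using hol(2) sub by (rule holomorphic_on_subset)
    then show "h holomorphic_on interior (cball 0 r)" "continuous_on (closure (cball 0 r)) h"
      by (auto intro: holomorphic_on_subset holomorphic_on_imp_continuous_on)
    fix u :: complex assume "u \<in> frontier (cball 0 r)"
    then have u: "cmod u = r" by simp
    then have "r ^ n * cmod (h u) \<le> M"
      using max[of u] ord[of u] r by (simp add: norm_mult norm_power r_def M_def)
    then show "cmod (h u) \<le> M / r ^ n"
      using r by (simp add: field_simps)
  qed (use that in auto)
  \<comment> \<open>The equation \<open>z0 * deriv w z0 = k * w z0\<close> amounts to
    \<open>P = k * M^2\<close>, so the claim is that \<open>P\<close> is real and at least
    \<open>n * M^2\<close>. Up to a factor 2, \<open>Re P\<close> and \<open>- Im P\<close> are the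
    radial and angular derivatives of \<open>|w|^2\<close> at \<open>z0\<close>.\<close>
  define P where "P = cnj (w z0) * (z0 * deriv w z0)"
  have "\<not> 2 * real n * M\<^sup>2 - 2 * Re P > 0"
  proof
    assume pos: "2 * real n * M\<^sup>2 - 2 * Re P > 0"
    have "((\<lambda>t. of_real t * z0) has_vector_derivative z0) (at (1::real))"
      by (auto intro!: derivative_eq_intros)
    then have "((\<lambda>t. (cmod (w (of_real t * z0)))\<^sup>2) has_real_derivative 2 * Re P) (at 1)"
      using has_real_derivative_cmod_sq_comp[of w "deriv w z0" "\<lambda>t. of_real t * z0" 1 z0] dw
      by (simp add: P_def mult_ac)
    moreover have "((\<lambda>t. M\<^sup>2 * t ^ (2 * n)) has_real_derivative 2 * real n * M\<^sup>2) (at 1)"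
      by (auto intro!: derivative_eq_intros)
    ultimately have "((\<lambda>t. M\<^sup>2 * t ^ (2 * n) - (cmod (w (of_real t * z0)))\<^sup>2)
        has_real_derivative 2 * real n * M\<^sup>2 - 2 * Re P) (at 1)"
      by (intro DERIV_diff)
    \<comment> \<open>The difference vanishes at \<open>t = 1\<close>, so a positive derivative
      makes it negative just to the left, against the bound
      \<open>|w (t * z0)| \<le> M * t^n\<close> coming from \<open>hbound\<close>.\<close>
    from has_real_derivative_pos_inc_left[OF this pos]
    obtain d where d: "d > 0" "\<And>s. 0 < s \<Longrightarrow> s < d \<Longrightarrow>
        M\<^sup>2 * (1 - s) ^ (2 * n) - (cmod (w (of_real (1 - s) * z0)))\<^sup>2 < 0"
      by (force simp: M_def)
    \<comment> \<open>The cap \<open>1 / 2\<close> keeps \<open>t\<close> positive when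
      \<open>d\<close> is large.\<close>
    define t where "t = 1 - min (d / 2) (1 / 2)"
    have t: "0 < t" "t < 1"
      using d(1) by (auto simp: t_def)
    have "M\<^sup>2 * t ^ (2 * n) < (cmod (w (of_real t * z0)))\<^sup>2"
      using d(2)[of "1 - t"] d(1) t by (simp add: t_def min_def split: if_splits)
    then have lt: "(M * t ^ n)\<^sup>2 < (cmod (w (of_real t * z0)))\<^sup>2"
      by (simp add: power_mult_distrib mult.commute flip: power_mult)
    have "of_real t * z0 \<in> cball 0 r"
      using t r by (simp add: norm_mult r_def)
    then have "cmod (w (of_real t * z0)) = (t * r) ^ n * cmod (h (of_real t * z0))"
      using ord[of "of_real t * z0"] sub t by (auto simp: norm_mult norm_power r_def)
    also have "\<dots> \<le> (t * r) ^ n * (M / r ^ n)"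
      using hbound \<open>of_real t * z0 \<in> cball 0 r\<close> t r by (intro mult_left_mono) auto
    also have "\<dots> = M * t ^ n"
      using r by (simp add: power_mult_distrib)
    finally show False
      using lt power_mono[of "cmod (w (of_real t * z0))" "M * t ^ n" 2] by simp
  qed
  then have Re: "real n * M\<^sup>2 \<le> Re P"
    by simp
  have "((\<lambda>z. z0 * exp (\<i> * z)) has_field_derivative z0 * \<i>) (at (of_real 0))"
    by (auto intro!: derivative_eq_intros)
  from has_vector_derivative_real_field[OF this]
  have "((\<lambda>t. z0 * cis t) has_vector_derivative z0 * \<i>) (at 0)"
    by (simp add: cis_conv_exp)
  then have "((\<lambda>t. (cmod (w (z0 * cis t)))\<^sup>2) has_real_derivative 2 * Re (P * \<i>)) (at 0)"
    using has_real_derivative_cmod_sq_comp[of w "deriv w z0" "\<lambda>t. z0 * cis t" 0 "z0 * \<i>"] dw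
    by (simp add: P_def mult_ac)
  \<comment> \<open>All points \<open>z0 * cis t\<close> have modulus \<open>|z0|\<close>, so the
    maximum at \<open>t = 0\<close> is global and the radius 1 is arbitrary.\<close>
  then have "2 * Re (P * \<i>) = 0"
    by (rule DERIV_local_max[of _ _ _ 1]) (auto intro!: power_mono max simp: norm_mult)
  then have "P = of_real (Re P)"
    by (simp add: complex_eq_iff)
  moreover have "w z0 * P = of_real (M\<^sup>2) * (z0 * deriv w z0)"
    by (simp add: P_def M_def complex_norm_square mult_ac del: of_real_power)
  ultimately have "z0 * deriv w z0 = of_real (Re P / M\<^sup>2) * w z0"
    using M by (simp add: field_simps)
  moreover have "Re P / M\<^sup>2 \<ge> real n"
    using Re M by (simp add: field_simps)
  ultimately show thesis
    using that by blast
qed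

section \<open>Order of vanishing at the origin\<close>

text \<open>The power \<open>z^(n - 1)\<close> is pulled out in the form that
  \<open>holomorphic_factor_of_deriv\<close> takes as input.\<close>

lemma DERIV_power_mult:
  assumes "(u has_field_derivative u') (at z)" and "n > 0"
  shows "((\<lambda>z. z ^ n * u z) has_field_derivative z ^ (n - 1) * (of_nat n * u z + z * u')) (at z)"
proof -
  have "((\<lambda>z. z ^ n * u z) has_field_derivative
      of_nat n * z ^ (n - 1) * u z + u' * z ^ n) (at z)"
    using DERIV_mult[OF DERIV_power[OF DERIV_ident] assms(1), of n] by simp
  moreover have "z ^ n = z * z ^ (n - 1)"
    using \<open>n > 0\<close> by (cases n) auto
  ultimately show ?thesis
    by (simp add: algebra_simps)
qed

text \<open>Near the origin \<open>|deriv w z| \<le> B * |z|^(n - 1)\<close>, hence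
  \<open>|w z| \<le> B * |z|^n\<close>. So \<open>w z / z^n\<close> is bounded there and its
  singularity is removable.\<close>

lemma holomorphic_factor_of_deriv:
  assumes w: "w holomorphic_on ball 0 R" "w 0 = 0" and q: "q holomorphic_on ball 0 R"
    and n: "n > 0" and R: "R > 0"
    and dw: "\<And>z. z \<in> ball 0 R \<Longrightarrow> deriv w z = z ^ (n - 1) * q z"
  obtains h where "h holomorphic_on ball 0 R" "\<And>z. z \<in> ball 0 R \<Longrightarrow> w z = z ^ n * h z"
proof -
  have sub: "cball 0 (R / 2) \<subseteq> ball (0::complex) R"
    using R by auto
  have "compact (q ` cball 0 (R / 2))"
    using q sub by (intro compact_continuous_image holomorphic_on_imp_continuous_on)
      (auto intro: holomorphic_on_subset)
  then obtain B where B: "\<And>z. z \<in> cball 0 (R / 2) \<Longrightarrow> cmod (q z) \<le> B"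
    by (meson bounded_iff compact_imp_bounded image_eqI)
  have bound: "cmod (w z / z ^ n) \<le> B" if z: "z \<in> cball 0 (R / 2)" "z \<noteq> 0" for z
  proof -
    have B0: "B \<ge> 0"
      using order_trans[OF norm_ge_zero B[of 0]] R by simp
    have "cmod (w z - w 0) \<le> (cmod z ^ (n - 1) * B) * cmod (z - 0)"
    proof (rule field_differentiable_bound[of "cball 0 (cmod z)"])
      fix u :: complex assume u: "u \<in> cball 0 (cmod z)"
      then have u': "u \<in> cball 0 (R / 2)" using z by auto
      then show "(w has_field_derivative deriv w u) (at u within cball 0 (cmod z))"
        using w(1) sub holomorphic_derivI[of w "ball 0 R" u] has_field_derivative_at_within by blast
      show "cmod (deriv w u) \<le> cmod z ^ (n - 1) * B"
        using B[OF u'] u B0 by (subst dw) (use u' sub in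
          \<open>auto simp: norm_mult norm_power intro!: mult_mono power_mono\<close>)
    qed auto
    also have "\<dots> = B * cmod z ^ n"
      using n by (cases n) auto
    finally show ?thesis
      using z w(2) by (simp add: norm_divide norm_power field_simps)
  qed
  have "\<exists>h. h holomorphic_on ball 0 R \<and> (\<forall>z\<in>ball 0 R - {0}. h z = w z / z ^ n)"
  proof (subst holomorphic_on_extend_bounded)
    show "\<exists>B. \<forall>\<^sub>F z in at 0. cmod (w z / z ^ n) \<le> B"
      using bound R by (intro exI[of _ B]) (auto simp: eventually_at intro!: exI[of _ "R / 2"])
  qed (use R w in \<open>auto intro!: holomorphic_intros intro: holomorphic_on_subset\<close>)
  then obtain h where h: "h holomorphic_on ball 0 R" "\<And>z. z \<in> ball 0 R - {0} \<Longrightarrow> h z = w z / z ^ n"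
    by blast
  \<comment> \<open>At the origin both sides vanish, as \<open>w 0 = 0\<close> and
    \<open>n > 0\<close>, whatever value the extension takes there.\<close>
  show thesis
    by (rule that[OF h(1)]) (use h(2) w(2) n in \<open>force simp: field_simps\<close>)
qed

text \<open>Dividing the tail of the series termwise by \<open>z^(m + 1)\<close> leaves a power
  series that converges on the whole disk; its value at the origin is \<open>a 0\<close>.\<close>

lemma class_A_factor:
  assumes "f \<in> class_A m"
  obtains u where "u holomorphic_on unit_disk"
    "\<And>z. z \<in> unit_disk \<Longrightarrow> f z = z + z ^ (m + 1) * u z"
proof -
  obtain a where a: "\<And>z. z \<in> unit_disk \<Longrightarrow> (\<lambda>k. a k * z ^ (m + 1 + k)) sums (f z - z)"
    using assms unfolding class_A_def by blast
  define u where "u z = (if z = 0 then a 0 else (f z - z) / z ^ (m + 1))" for z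
  have "u holomorphic_on unit_disk"
  proof (rule power_series_holomorphic)
    fix z :: complex assume z: "z \<in> unit_disk"
    show "(\<lambda>k. a k * (z - 0) ^ k) sums u z"
    proof (cases "z = 0")
      case True
      then show ?thesis using powser_sums_zero[of a] by (simp add: u_def)
    next
      case False
      have "(\<lambda>k. a k * z ^ (m + 1 + k) / z ^ (m + 1)) sums ((f z - z) / z ^ (m + 1))"
        by (intro sums_divide a z)
      then show ?thesis using False by (simp add: u_def power_add field_simps)
    qed
  qed
  \<comment> \<open>For \<open>z = 0\<close> every term of the series is zero, which forces
    \<open>f 0 = 0\<close>.\<close>
  moreover have "f z = z + z ^ (m + 1) * u z" if "z \<in> unit_disk" for z
    using a[OF that] sums_unique2[OF _ sums_zero, of "f 0"] by (auto simp: u_def)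
  ultimately show thesis using that by blast
qed


text \<open>The coefficient sequence is padded with \<open>n - m\<close> leading zeros.\<close>

lemma class_A_mono:
  assumes f: "f \<in> class_A n" and "m \<le> n"
  shows "f \<in> class_A m"
proof -
  obtain a where a: "\<And>z. z \<in> unit_disk \<Longrightarrow> (\<lambda>k. a k * z ^ (n + 1 + k)) sums (f z - z)"
    using f unfolding class_A_def by blast
  define b where "b k = (if k < n - m then 0 else a (k - (n - m)))" for k
  have "(\<lambda>k. b k * z ^ (m + 1 + k)) sums (f z - z)" if z: "z \<in> unit_disk" for z
  proof -
    have "(\<lambda>k. b (k + (n - m)) * z ^ (m + 1 + (k + (n - m)))) sums (f z - z)"
    proof -
      have "b (k + (n - m)) * z ^ (m + 1 + (k + (n - m))) = a k * z ^ (n + 1 + k)" for k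
        using \<open>m \<le> n\<close> by (simp add: b_def add.commute)
      then show ?thesis using a[OF z] by (simp only:)
    qed
    then show ?thesis
      by (subst (asm) sums_iff_shift) (simp add: b_def)
  qed
  then show ?thesis
    using f unfolding class_A_def by blast
qed

text \<open>With \<open>f' = 1 + z^n1 * U\<close> and \<open>g = z * G\<close>,
  \<open>G = 1 + z^n2 * v\<close>, the factor \<open>z\<close> cancels in the quotient, and
  \<open>f' - G\<close> is divisible by \<open>z^n\<close> because \<open>n\<close> is the smaller
  exponent.\<close>

lemma zderiv_quot_factor:
  assumes f: "f \<in> class_A n1" and g: "g \<in> class_A n2" and n: "n > 0" "n = min n1 n2"
    and gnz: "\<And>z. z \<in> unit_disk - {0} \<Longrightarrow> g z \<noteq> 0"
  obtains H where "H holomorphic_on unit_disk"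
    "\<And>z. z \<in> unit_disk \<Longrightarrow> zderiv_quot f g z = 1 + z ^ n * H z"
proof -
  obtain u where u: "u holomorphic_on unit_disk"
    "\<And>z. z \<in> unit_disk \<Longrightarrow> f z = z + z ^ (n1 + 1) * u z"
    using class_A_factor[OF f] by blast
  obtain v where v: "v holomorphic_on unit_disk"
    "\<And>z. z \<in> unit_disk \<Longrightarrow> g z = z + z ^ (n2 + 1) * v z"
    using class_A_factor[OF g] by blast
  define U where "U z = of_nat (n1 + 1) * u z + z * deriv u z" for z
  define G where "G z = 1 + z ^ n2 * v z" for z
  define H where "H z = (z ^ (n1 - n) * U z - z ^ (n2 - n) * v z) / G z" for z
  have f': "deriv f z = 1 + z ^ n1 * U z" if z: "z \<in> unit_disk" for z
  proof (rule DERIV_imp_deriv, rule has_field_derivative_transform_within_open[OF _ open_ball z])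
    show "((\<lambda>z. z + z ^ (n1 + 1) * u z) has_field_derivative 1 + z ^ n1 * U z) (at z)"
      using DERIV_add[OF DERIV_ident
          DERIV_power_mult[OF holomorphic_derivI[OF u(1) open_ball z], of "n1 + 1"]]
      by (simp add: U_def)
  qed (simp add: u(2))
  have gG: "g z = z * G z" if "z \<in> unit_disk" for z
    using v(2)[OF that] by (simp add: G_def algebra_simps)
  \<comment> \<open>The zeros of \<open>g\<close> say nothing about \<open>G\<close> at the origin;
    there \<open>G 0 = 1\<close> because \<open>n2 > 0\<close>.\<close>
  have Gnz: "G z \<noteq> 0" if "z \<in> unit_disk" for z
    using gnz[of z] gG[OF that] that n by (cases "z = 0") (auto simp: G_def power_0_left)
  have "U holomorphic_on unit_disk" "G holomorphic_on unit_disk"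
    unfolding U_def G_def using u(1) v(1) by (auto intro!: holomorphic_intros)
  then have "H holomorphic_on unit_disk"
    unfolding H_def using Gnz v(1) by (auto intro!: holomorphic_intros)
  moreover have "zderiv_quot f g z = 1 + z ^ n * H z" if z: "z \<in> unit_disk" for z
  proof (cases "z = 0")
    case False
    have "z ^ n * (z ^ (n1 - n) * U z - z ^ (n2 - n) * v z) = z ^ n1 * U z - z ^ n2 * v z"
      using n(2) by (simp add: algebra_simps flip: power_add)
    then have "z ^ n * H z = (z ^ n1 * U z - z ^ n2 * v z) / G z"
      by (simp add: H_def)
    also have "\<dots> = (1 + z ^ n1 * U z) / G z - 1"
      using Gnz[OF z] by (simp add: divide_simps) (simp add: G_def)
    finally have "1 + z ^ n * H z = (1 + z ^ n1 * U z) / G z"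
      by simp
    then show ?thesis
      using False f'[OF z] gG[OF z] by (simp add: zderiv_quot_def)
  next
    case True
    then show ?thesis using n(1) by (simp add: zderiv_quot_def)
  qed
  ultimately show thesis using that by blast
qed

section \<open>Logarithmic derivatives of the quotient and of the branch of its power\<close>

lemma deriv_zderiv_quot:
  assumes hol: "f holomorphic_on unit_disk" "g holomorphic_on unit_disk"
    and z: "z \<in> unit_disk" "z \<noteq> 0" and nz: "deriv f z \<noteq> 0" "g z \<noteq> 0"
  shows "z * deriv (zderiv_quot f g) z / zderiv_quot f g z =
    1 + z * deriv (deriv f) z / deriv f z - zderiv_quot g g z"
proof -
  have df: "(f has_field_derivative deriv f z) (at z)"
    "(deriv f has_field_derivative deriv (deriv f) z) (at z)"
    "(g has_field_derivative deriv g z) (at z)"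
    using hol z(1) by (auto intro!: holomorphic_derivI[of _ unit_disk] holomorphic_deriv)
  \<comment> \<open>On the open set \<open>- {0}\<close> the case distinction in
    \<open>zderiv_quot\<close> disappears.\<close>
  have "deriv (zderiv_quot f g) z =
    ((deriv f z + z * deriv (deriv f) z) * g z - z * deriv f z * deriv g z) / (g z * g z)"
  proof (rule DERIV_imp_deriv,
      rule has_field_derivative_transform_within_open[of "\<lambda>z. z * deriv f z / g z" _ _ "- {0}"])
    show "((\<lambda>z. z * deriv f z / g z) has_field_derivative
      ((deriv f z + z * deriv (deriv f) z) * g z - z * deriv f z * deriv g z) / (g z * g z)) (at z)"
      using nz by (auto intro!: derivative_eq_intros df simp: algebra_simps)
  qed (use z in \<open>auto simp: zderiv_quot_def\<close>)
  then show ?thesis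
    using z nz by (simp add: zderiv_quot_def field_simps)
qed

context
  fixes F :: "complex \<Rightarrow> complex"
  assumes hol: "F holomorphic_on unit_disk" and nz: "\<And>z. z \<in> unit_disk \<Longrightarrow> F z \<noteq> 0"
    and F0: "F 0 = 1"
begin

lemma holomorphic_on_disk_power: "disk_power F a holomorphic_on unit_disk"
  unfolding disk_power_def[abs_def]
  using disk_log(1)[OF hol _ F0] nz by (auto intro!: holomorphic_intros)

lemma disk_power_0: "disk_power F a 0 = 1"
  using disk_log(2)[OF hol _ F0] nz by (simp add: disk_power_def)

text \<open>Differentiating \<open>exp L = F\<close> for the chosen logarithm \<open>L\<close> gives
  \<open>L' = F' / F\<close>; the chain rule does the rest.\<close>

lemma deriv_disk_power:
  assumes z: "z \<in> unit_disk"
  shows "deriv (disk_power F a) z = of_real a * disk_power F a z * (deriv F z / F z)"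
proof -
  have L: "disk_log F holomorphic_on unit_disk" "exp (disk_log F u) = F u" if "u \<in> unit_disk" for u
    using disk_log(1,3)[OF hol _ F0] nz that by auto
  have dL: "(disk_log F has_field_derivative deriv (disk_log F) z) (at z)"
    using L(1)[OF z] z by (auto intro: holomorphic_derivI)
  have "((\<lambda>z. exp (disk_log F z)) has_field_derivative F z * deriv (disk_log F) z) (at z)"
    using L(2)[OF z] by (auto intro!: derivative_eq_intros dL)
  then have "(F has_field_derivative F z * deriv (disk_log F) z) (at z)"
    by (rule has_field_derivative_transform_within_open[OF _ open_ball z]) (simp add: L(2))
  then have "deriv (disk_log F) z = deriv F z / F z"
    using nz[OF z] by (simp add: DERIV_imp_deriv)
  moreover have "(disk_power F a has_field_derivative
      of_real a * disk_power F a z * deriv (disk_log F) z) (at z)"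
    unfolding disk_power_def[abs_def] by (auto intro!: derivative_eq_intros dL)
  ultimately show ?thesis
    by (simp add: DERIV_imp_deriv)
qed

text \<open>The order of vanishing passes through derivatives: \<open>F'\<close> has the factor
  \<open>z^(n - 1)\<close>, hence so has the derivative of the power, with cofactor
  \<open>q\<close>, and \<open>holomorphic_factor_of_deriv\<close> integrates this back.\<close>

lemma disk_power_factor:
  assumes H: "H holomorphic_on unit_disk" "\<And>z. z \<in> unit_disk \<Longrightarrow> F z = 1 + z ^ n * H z"
    and n: "n > 0"
  obtains h where "h holomorphic_on unit_disk"
    "\<And>z. z \<in> unit_disk \<Longrightarrow> disk_power F a z - 1 = z ^ n * h z"
proof -
  define q where "q z = of_real a * disk_power F a z * ((of_nat n * H z + z * deriv H z) / F z)" for z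
  have q: "q holomorphic_on unit_disk"
    unfolding q_def using H(1) hol nz holomorphic_on_disk_power
    by (auto intro!: holomorphic_intros)
  have w: "(\<lambda>z. disk_power F a z - 1) holomorphic_on unit_disk"
    using holomorphic_on_disk_power by (auto intro!: holomorphic_intros)
  have dw: "deriv (\<lambda>z. disk_power F a z - 1) z = z ^ (n - 1) * q z" if z: "z \<in> unit_disk" for z
  proof -
    have "deriv F z = z ^ (n - 1) * (of_nat n * H z + z * deriv H z)"
    proof (rule DERIV_imp_deriv, rule has_field_derivative_transform_within_open[OF _ open_ball z])
      show "((\<lambda>z. 1 + z ^ n * H z) has_field_derivative
          z ^ (n - 1) * (of_nat n * H z + z * deriv H z)) (at z)"
        using DERIV_add[OF DERIV_const DERIV_power_mult[OF holomorphic_derivI[OF H(1) open_ball z] n]]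
        by simp
    qed (simp add: H(2))
    moreover have "deriv (\<lambda>z. disk_power F a z - 1) z = deriv (disk_power F a) z"
      using holomorphic_on_imp_differentiable_at[OF holomorphic_on_disk_power open_ball z]
      by (subst deriv_diff) auto
    ultimately show ?thesis
      by (simp add: deriv_disk_power[OF z] q_def)
  qed
  show thesis
    using holomorphic_factor_of_deriv[OF w _ q n _ dw] disk_power_0 that by auto
qed

end

section \<open>Real powers, and the map \<open>w / (1 + w)\<close> on the unit circle\<close>

lemma real_power_1: "real_power 1 a = 1"
  by (simp add: real_power_def)

lemma real_power_mono:
  assumes "0 \<le> x" "x \<le> y" "0 \<le> a"
  shows "real_power x a \<le> real_power y a"
  using assms by (auto simp: real_power_def intro: power_mono powr_mono2)

text \<open>On the unit circle \<open>|1 + w|^2 = 2 * (1 + Re w)\<close>, while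
  \<open>w * cnj (1 + w)\<close> has real part \<open>1 + Re w\<close>.\<close>

lemma Re_div_one_plus:
  assumes "cmod w = 1" "w \<noteq> -1"
  shows "Re (w / (1 + w)) = 1 / 2"
proof -
  have *: "(Re w)\<^sup>2 + (Im w)\<^sup>2 = 1"
    using assms(1) cmod_power2[of w] by simp
  have "Re w \<noteq> -1"
    using * assms(2) by (auto simp: complex_eq_iff)
  moreover have "(1 + Re w)\<^sup>2 + (Im w)\<^sup>2 = 2 * (1 + Re w)"
    using * by (simp add: power2_eq_square algebra_simps)
  ultimately show ?thesis
    using * by (simp add: Re_divide power2_eq_square field_simps)
qed

section \<open>The extremal point where \<open>|w|\<close> first reaches 1\<close>

theorem theorem1:
  fixes n1 n2 n :: nat and f g :: "complex \<Rightarrow> complex"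
    and \<beta> \<gamma> \<mu> :: real and \<delta> :: complex
  assumes "n1 > 0" and "n2 > 0" and "n = min n1 n2"
    and "f \<in> class_A n1" and "g \<in> class_A n2 \<inter> starlike_order 0"
    and "\<beta> \<ge> 0" and "\<gamma> \<ge> 0" and "\<beta> + \<gamma> > 0"
    and "0 < \<mu>" and "\<mu> \<le> 1"
    and "Re \<delta> > - (\<mu> * real n / 2)"
    and "\<forall>z\<in>unit_disk. deriv f z \<noteq> 0"
    and "\<gamma> \<notin> \<nat> \<Longrightarrow>
      \<forall>z\<in>unit_disk. Re (\<delta> + 1 + z * deriv (deriv f) z / deriv f z - zderiv_quot g g z) \<ge> 0"
    and "\<forall>z\<in>unit_disk.
      real_power (cmod (disk_power (zderiv_quot f g) (1 / \<mu>) z - 1)) \<beta> *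
      real_power (Re (\<delta> + 1 + z * deriv (deriv f) z / deriv f z - zderiv_quot g g z)) \<gamma>
      < real_power (Re \<delta> + \<mu> * real n / 2) \<gamma>"
  shows "(\<forall>z\<in>unit_disk. cmod (disk_power (zderiv_quot f g) (1 / \<mu>) z - 1) < 1) \<and>
    f \<in> strongly_close_to_convex \<mu>"
proof -
  define F where "F = zderiv_quot f g"
  define p where "p = disk_power F (1 / \<mu>)"
  define w where "w z = p z - 1" for z
  note fnz = assms(12)[rule_format]
  note hyp = assms(14)[folded F_def, folded p_def, rule_format]
  have hol: "f holomorphic_on unit_disk" "g holomorphic_on unit_disk"
    and gnz: "\<And>z. z \<in> unit_disk - {0} \<Longrightarrow> g z \<noteq> 0"
    using assms(4,5) by (auto simp: class_A_def starlike_order_def)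
  have n: "n > 0"
    using assms(1-3) by simp
  obtain H where H: "H holomorphic_on unit_disk"
      "\<And>z. z \<in> unit_disk \<Longrightarrow> F z = 1 + z ^ n * H z"
    using zderiv_quot_factor[OF assms(4) _ n assms(3), of g] gnz assms(5) unfolding F_def by blast
  \<comment> \<open>Holomorphy of \<open>F\<close> at the origin, where it is defined by cases, is
    read off from the factorization.\<close>
  have "(\<lambda>z. 1 + z ^ n * H z) holomorphic_on unit_disk"
    by (intro holomorphic_intros H(1))
  then have F: "F holomorphic_on unit_disk"
    by (rule holomorphic_transform) (simp add: H(2))
  have Fnz: "F z \<noteq> 0" if "z \<in> unit_disk" for z
    using that fnz gnz by (auto simp: F_def zderiv_quot_def)
  have F0: "F 0 = 1"
    by (simp add: F_def zderiv_quot_def)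
  note P = F Fnz F0
  \<comment> \<open>This excludes \<open>w = -1\<close>, the pole of
    \<open>w / (1 + w)\<close>.\<close>
  have pnz: "p z \<noteq> 0" for z
    by (simp add: p_def disk_power_def)
  have p_hol: "p holomorphic_on unit_disk"
    unfolding p_def by (rule holomorphic_on_disk_power[OF P])
  have w_hol: "w holomorphic_on unit_disk"
    unfolding w_def by (intro holomorphic_intros p_hol)
  obtain h where h: "h holomorphic_on unit_disk" "\<And>z. z \<in> unit_disk \<Longrightarrow> w z = z ^ n * h z"
    using disk_power_factor[OF P H n] unfolding w_def p_def by blast
  have "cmod (w z) < 1" if z1: "z \<in> unit_disk" for z
  proof (rule ccontr)
    assume ge: "\<not> cmod (w z) < 1"
    have sub: "cball 0 (cmod z) \<subseteq> unit_disk"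
      using z1 by auto
    have cont: "continuous_on (cball 0 (cmod z)) w"
      using holomorphic_on_imp_continuous_on[OF holomorphic_on_subset[OF w_hol sub]] .
    \<comment> \<open>Restricting to the closed disk through \<open>z\<close> makes the set compact,
      so the least modulus is attained.\<close>
    define S where "S = cball 0 (cmod z) \<inter> (\<lambda>u. cmod (w u)) -` {1..}"
    have "closed S"
      unfolding S_def by (intro continuous_closed_preimage continuous_on_norm cont) auto
    then have "compact S"
      unfolding S_def compact_eq_bounded_closed
      by (auto intro: bounded_subset[OF bounded_cball])
    moreover have "z \<in> S"
      using ge by (simp add: S_def)
    ultimately obtain z0 where z0: "z0 \<in> S" "\<And>u. u \<in> S \<Longrightarrow> cmod z0 \<le> cmod u"
      using continuous_attains_inf[of S cmod] continuous_on_norm_id by auto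
    have z0': "z0 \<in> unit_disk" "cmod (w z0) \<ge> 1" "cmod z0 \<le> cmod z"
      using z0(1) sub by (auto simp: S_def)
    have less: "cmod (w u) < 1" if "cmod u < cmod z0" for u
      using that z0(2)[of u] z0'(3) by (force simp: S_def)
    have z0nz: "z0 \<noteq> 0"
      using z0'(2) h(2)[of 0] n by (auto simp: power_0_left)
    \<comment> \<open>The strict bound inside passes to the closed disk by continuity; the closure
      of the ball is the closed disk because \<open>z0\<close> is not 0. This yields both
      \<open>|w z0| = 1\<close> and the maximality required by \<open>jack_lemma\<close>.\<close>
    have le: "cmod (w u) \<le> 1" if "cmod u \<le> cmod z0" for u
    proof -
      have "u \<in> closure (ball 0 (cmod z0))"
        using that z0nz by simp
      moreover have "continuous_on (closure (ball 0 (cmod z0))) w"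
        by (rule continuous_on_subset[OF cont]) (use z0'(3) z0nz in auto)
      ultimately show ?thesis
        using less by (intro continuous_on_closure_norm_le) (auto intro: less_imp_le)
    qed
    have w1: "cmod (w z0) = 1"
      using le[of z0] z0'(2) by simp
    obtain k where k: "k \<ge> real n" "z0 * deriv w z0 = of_real k * w z0"
      by (rule jack_lemma[OF w_hol h z0'(1) _ z0nz]) (use w1 le in auto)
    have "deriv w z0 = deriv p z0"
      unfolding w_def using holomorphic_on_imp_differentiable_at[OF p_hol open_ball z0'(1)]
      by (subst deriv_diff) auto
    also have "\<dots> = of_real (1 / \<mu>) * p z0 * (deriv F z0 / F z0)"
      unfolding p_def by (rule deriv_disk_power[OF P z0'(1)])
    finally have "z0 * deriv F z0 / F z0 = of_real \<mu> * (z0 * deriv w z0) / p z0"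
      using pnz[of z0] assms(9) by (simp add: field_simps)
    also have "\<dots> = of_real (\<mu> * k) * (w z0 / (1 + w z0))"
      by (simp add: k(2) w_def)
    finally have "Re (z0 * deriv F z0 / F z0) = \<mu> * k * Re (w z0 / (1 + w z0))"
      by (simp only: times_complex.sel Re_complex_of_real Im_complex_of_real mult_zero_left diff_zero)
    also have "Re (w z0 / (1 + w z0)) = 1 / 2"
      using w1 pnz[of z0] by (intro Re_div_one_plus) (auto simp: w_def)
    finally have "Re (z0 * deriv F z0 / F z0) = \<mu> * k / 2"
      by simp
    then have "Re (1 + z0 * deriv (deriv f) z0 / deriv f z0 - zderiv_quot g g z0) = \<mu> * k / 2"
      using deriv_zderiv_quot[OF hol z0'(1) z0nz fnz gnz] z0'(1) z0nz by (simp add: F_def)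
    then have "Re (\<delta> + 1 + z0 * deriv (deriv f) z0 / deriv f z0 - zderiv_quot g g z0)
        = Re \<delta> + \<mu> * k / 2"
      by simp
    moreover have "\<mu> * real n / 2 \<le> \<mu> * k / 2"
      using k(1) assms(9) by simp
    \<comment> \<open>The smaller base is positive by the assumption on \<open>\<delta>\<close>, so
      \<open>real_power\<close> is monotone here for every \<open>\<gamma> \<ge> 0\<close>.\<close>
    ultimately have "real_power (Re \<delta> + \<mu> * real n / 2) \<gamma> \<le>
        real_power (Re (\<delta> + 1 + z0 * deriv (deriv f) z0 / deriv f z0 - zderiv_quot g g z0)) \<gamma>"
      using assms(7,11) by (intro real_power_mono) auto
    \<comment> \<open>Since \<open>|w z0| = 1\<close>, the first factor of the hypothesis is 1 for
      every \<open>\<beta>\<close>.\<close>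
    then show False
      using hyp[OF z0'(1)] w1 by (simp add: w_def real_power_1)
  qed
  then have less: "cmod (p z - 1) < 1" if "z \<in> unit_disk" for z
    using that by (simp add: w_def)
  have "Re (p z) > 0" if "z \<in> unit_disk" for z
    using less[OF that] abs_Re_le_cmod[of "p z - 1"] by simp
  moreover have "f \<in> class_A 1"
    using class_A_mono[OF assms(4)] assms(1) by simp
  ultimately have "f \<in> strongly_close_to_convex \<mu>"
    using assms(5,12) by (auto simp: strongly_close_to_convex_def p_def F_def intro!: bexI[of _ g])
  then show ?thesis
    using less by (simp add: p_def F_def)
qed

end
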